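(* Every rank-biased leftist heap can be generated using the operations $\mathrm{empty}$, $\mathrm{single}$ and $\mathrm{union}$; that is, every rank-biased leftist heap belongs to the smallest set of trees that contains $\langle\rangle$ and $\langle a\rangle$ for every label $a$, and is closed under $(x,y)\mapsto x\oplus y$.
   Context: Binary trees with labels from a totally ordered set $A$: $\langle\rangle$ is the empty tree, $\langle t,a,u\rangle$ has left subtree $t$, root label $a$, right subtree $u$; $\langle a\rangle=\langle\langle\rangle,a,\langle\rangle\rangle$. Rank: $\mathrm{rank}\langle\rangle=0$, $\mathrm{rank}\langle t,a,u\rangle=\mathrm{rank}\,u+1$. A rank-biased leftist heap is such a tree in which every label is $\le$ all labels in its subtrees and $\mathrm{rank}\,t\ge\mathrm{rank}\,u$ at every node $\langle t,a,u\rangle$. Operations: $\mathrm{empty}=\langle\rangle$, $\mathrm{single}(a)=\langle a\rangle$, $\mathrm{union}(x,y)=x\oplus y$. Let $\mathrm{min}(\langle\rangle)=\infty$ (larger than all labels) and $\mathrm{min}\langle t,a,u\rangle=a$. The meld $\oplus$: $\langle\rangle\oplus\langle\rangle=\langle\rangle$; $\langle t,a,u\rangle\oplus y=\mathrm{bal}\langle t,a,u\oplus y\rangle$ if $a\le\mathrm{min}(y)$; otherwise $x\oplus\langle t,a,u\rangle=\mathrm{bal}\langle t,a,x\oplus u\rangle$; where $\mathrm{bal}\langle t,a,u\rangle=\langle t,a,u\rangle$ if $\mathrm{rank}\,t>\mathrm{rank}\,u$ and $\mathrm{bal}\langle t,a,u\rangle=\langle u,a,t\rangle$ if $\mathrm{rank}\,t\le\mathrm{rank}\,u$.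 *)

theory Defs
  imports "HOL-Library.Tree" "HOL-Library.Extended"
begin

fun rank :: "'a tree \<Rightarrow> nat" where
  "rank \<langle>\<rangle> = 0"
| "rank \<langle>t, a, u\<rangle> = rank u + 1"

fun rank_biased :: "'a tree \<Rightarrow> bool" where
  "rank_biased \<langle>\<rangle> \<longleftrightarrow> True"
| "rank_biased \<langle>t, a, u\<rangle> \<longleftrightarrow> rank t \<ge> rank u \<and> rank_biased t \<and> rank_biased u"

text \<open>The library predicate \<^const>\<open>heap\<close> says that every label is at most all labels
  in its two subtrees.\<close>

definition leftist_heap :: "'a::linorder tree \<Rightarrow> bool" where
  "leftist_heap t \<longleftrightarrow> heap t \<and> rank_biased t"

text \<open>The empty tree has minimum \<^const>\<open>Pinf\<close>, which is larger than \<^term>\<open>Fin a\<close> for every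
  label; the element \<^const>\<open>Minf\<close> of the library type is never a value of \<open>min_label\<close>.\<close>

fun min_label :: "'a tree \<Rightarrow> 'a extended" where
  "min_label \<langle>\<rangle> = Pinf"
| "min_label \<langle>t, a, u\<rangle> = Fin a"

text \<open>\<open>bal t a u\<close> is the balanced form of the nonempty tree \<^term>\<open>\<langle>t, a, u\<rangle>\<close>.\<close>

definition bal :: "'a tree \<Rightarrow> 'a \<Rightarrow> 'a tree \<Rightarrow> 'a tree" where
  "bal t a u = (if rank t > rank u then \<langle>t, a, u\<rangle> else \<langle>u, a, t\<rangle>)"

text \<open>The last equation covers exactly the arguments left over by the first two: if
  \<open>x = \<langle>\<rangle>\<close>, its condition holds because \<^term>\<open>min_label \<langle>\<rangle> = Pinf\<close>; otherwise it is the
  negation of the condition of the second equation.\<close>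

function meld :: "'a::linorder tree \<Rightarrow> 'a tree \<Rightarrow> 'a tree" (infixl "\<oplus>" 65) where
  "\<langle>\<rangle> \<oplus> \<langle>\<rangle> = \<langle>\<rangle>"
| "Fin a \<le> min_label y \<Longrightarrow> \<langle>t, a, u\<rangle> \<oplus> y = bal t a (u \<oplus> y)"
| "\<not> min_label x \<le> Fin a \<Longrightarrow> x \<oplus> \<langle>t, a, u\<rangle> = bal t a (x \<oplus> u)"
proof (goal_cases)
  case (1 P xy)
  obtain x y where xy: "xy = (x, y)" by force
  show ?case
    by (cases x; cases y) (use 1 xy in \<open>force simp: not_le\<close>)+
qed auto
termination by (relation "measure (\<lambda>(x, y). size x + size y)") auto

inductive_set generated :: "'a::linorder tree set" where
  empty: "\<langle>\<rangle> \<in> generated"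
| single: "\<langle>\<langle>\<rangle>, a, \<langle>\<rangle>\<rangle> \<in> generated"
| union: "x \<in> generated \<Longrightarrow> y \<in> generated \<Longrightarrow> x \<oplus> y \<in> generated"

end

theory Submission
  imports Defs
begin

text \<open>Melding with the empty tree is not the identity, since \<^const>\<open>bal\<close> swaps subtrees of equal
  rank, but it is surjective on leftist heaps and preserves size and labels. Given a leftist heap
  \<^term>\<open>\<langle>t, a, u\<rangle>\<close>, choose \<open>s\<close> with \<^term>\<open>\<langle>\<rangle> \<oplus> s = t\<close>; as \<^term>\<open>rank u \<le> rank t\<close>, melding
  \<^term>\<open>\<langle>u, a, \<langle>\<rangle>\<rangle>\<close> with \<open>s\<close> yields \<^term>\<open>bal u a t = \<langle>t, a, u\<rangle>\<close>. If \<open>t\<close> is nonempty, both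
  arguments are smaller than the result.\<close>

lemma Fin_le_min_label_iff: "heap t \<Longrightarrow> Fin a \<le> min_label t \<longleftrightarrow> (\<forall>x\<in>set_tree t. a \<le> x)"
  by (cases t) (auto intro: order_trans)

lemma meld_empty_left_Node: "\<langle>\<rangle> \<oplus> \<langle>t, a, u\<rangle> = bal t a (\<langle>\<rangle> \<oplus> u)"
  by simp

text \<open>Melding with \<open>\<langle>\<rangle>\<close> applies \<open>bal\<close> along the
  right spine, and ranks tell how to undo each application.\<close>

lemma meld_empty_left_surj:
  assumes "leftist_heap t"
  obtains s where "leftist_heap s" "\<langle>\<rangle> \<oplus> s = t" "size s = size t" "set_tree s = set_tree t"
proof -
  \<comment> \<open>Equality of ranks strengthens the induction: it makes the witnesses below
    rank-biased.\<close>
  have "\<exists>s. leftist_heap s \<and> \<langle>\<rangle> \<oplus> s = t \<and> size s = size t \<and> set_tree s = set_tree t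
      \<and> rank s = rank t"
    using assms
  proof (induction t)
    case Leaf
    then show ?case by (intro exI[of _ "\<langle>\<rangle>"]) simp
  next
    case (Node l a r)
    then have lr: "leftist_heap l" "leftist_heap r" "rank r \<le> rank l"
      and le: "\<forall>x\<in>set_tree l \<union> set_tree r. a \<le> x"
      by (auto simp: leftist_heap_def)
    show ?case
    proof (cases "rank r < rank l")
      case True
      obtain s where "leftist_heap s" "\<langle>\<rangle> \<oplus> s = r" "size s = size r" "set_tree s = set_tree r"
        "rank s = rank r"
        using Node.IH(2) lr(2) by blast
      then show ?thesis using True lr le
        by (intro exI[of _ "\<langle>l, a, s\<rangle>"])
          (auto simp: leftist_heap_def bal_def meld_empty_left_Node)
    next
      case False
      \<comment> \<open>The ranks agree, so \<open>bal\<close> will swap; the witness has its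
        subtrees exchanged in advance.\<close>
      obtain s where "leftist_heap s" "\<langle>\<rangle> \<oplus> s = l" "size s = size l" "set_tree s = set_tree l"
        "rank s = rank l"
        using Node.IH(1) lr(1) by blast
      then show ?thesis using False lr le
        by (intro exI[of _ "\<langle>r, a, s\<rangle>"])
          (auto simp: leftist_heap_def bal_def meld_empty_left_Node)
    qed
  qed
  then show ?thesis using that by blast
qed

theorem theorem3:
  fixes t :: "'a::linorder tree"
  assumes "leftist_heap t"
  shows "t \<in> generated"
  using assms
proof (induction t rule: measure_induct_rule[of size])
  case (less h)
  show ?case
  proof (cases h)
    case Leaf
    then show ?thesis by (simp add: generated.empty)
  next
    case (Node t a u)
    with less.prems have t: "leftist_heap t" and rank: "rank u \<le> rank t"
      and le: "\<forall>x\<in>set_tree t. a \<le> x" and ua: "leftist_heap \<langle>u, a, \<langle>\<rangle>\<rangle>"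
      by (auto simp: leftist_heap_def)
    show ?thesis
    proof (cases "t = \<langle>\<rangle>")
      case True
      with rank have "u = \<langle>\<rangle>" by (cases u) auto
      with True Node show ?thesis by (simp add: generated.single)
    next
      case False
      obtain s where s: "leftist_heap s" "\<langle>\<rangle> \<oplus> s = t" "size s = size t" "set_tree s = set_tree t"
        using meld_empty_left_surj[OF t] .
      \<comment> \<open>This makes \<open>meld\<close> keep \<open>a\<close> at the root; it is why
        \<open>s\<close> must have the labels of \<open>t\<close>.\<close>
      have "Fin a \<le> min_label s"
        using s le by (simp add: Fin_le_min_label_iff leftist_heap_def)
      then have "h = \<langle>u, a, \<langle>\<rangle>\<rangle> \<oplus> s"
        using s rank Node by (simp add: bal_def)
      moreover have "s \<in> generated"
        using less.IH s Node by simp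
      moreover have "\<langle>u, a, \<langle>\<rangle>\<rangle> \<in> generated"
        using less.IH ua False Node by (simp add: neq_Leaf_iff) auto
      ultimately show ?thesis by (simp add: generated.union)
    qed
  qed
qed

end
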